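(* Let $\mathcal{U}$ and $\mathcal{Y}$ be real Hilbert spaces, let $n \in \mathbb{N}$, and let $\bar{u} := (u_1,u_2,\dots,u_n) \in \mathcal{U}^n$ and $\bar{y} := (y_1,y_2,\dots,y_n) \in \mathcal{Y}^n$ be data. Consider a symmetric positive semidefinite kernel $K: \mathcal{U}\times \mathcal{U} \to \mathcal{B}(\mathcal{Y})$, and let $\mathcal{H}$ be its associated reproducing kernel Hilbert space (of operators from $\mathcal{U}$ to $\mathcal{Y}$). Assume that $K$ is nonexpansive. For $\gamma > 0$, let $\hat{H} \in \mathcal{H}$ denote the unique solution to the regularized least squares problem $$\min_{H \in \mathcal{H}} \left( \sum_{i=1}^n \|y_i - H(u_i)\|^2_{\mathcal{Y}} + \gamma \|H\|_{\mathcal{H}}^2 \right),$$ and let $G : \mathcal{Y}^n \to \mathcal{Y}^n$ be the Gram operator associated with $K$ and $\bar{u}$. Then the following statements hold: (a) Every $H \in \mathcal{H}$ is Lipschitz continuous with constant $\|H\|_{\mathcal{H}}$, i.e., $\|H(u)-H(v)\|_{\mathcal{Y}} \leq \|H\|_{\mathcal{H}} \|u-v\|_{\mathcal{U}}$ for all $u,v \in \mathcal{U}$. (b) For every $\gamma > 0$, the solution $\hat{H}$ to the regularized least squares problem has norm $$\|\hat{H}\|_{\mathcal{H}} = \|G^{\frac{1}{2}}(G+\gamma I)^{-1} \bar{y}\|_{\mathcal{Y}^n}.$$ (c) Thus, for a nonnegative real constant $\ell$, $\hat{H}$ is Lipschitz continuous with constant $\ell$ if $\gamma > 0$ satisfies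 $$\|G^{\frac{1}{2}}(G+\gamma I)^{-1} \bar{y}\|_{\mathcal{Y}^n} \leq \ell.$$
   Context: $\mathcal{B}(\mathcal{Y})$ denotes the bounded linear operators on $\mathcal{Y}$ with the operator norm $\|\cdot\|_{\mathcal{B}(\mathcal{Y})}$; $I$ is the identity operator. "Operators" from $\mathcal{U}$ to $\mathcal{Y}$ are arbitrary (not necessarily linear) maps. A mapping $K:\mathcal{U}\times\mathcal{U}\to\mathcal{B}(\mathcal{Y})$ is symmetric if $K(u,v)^* = K(v,u)$ for all $u,v \in \mathcal{U}$, and positive semidefinite if $\sum_{i=1}^n\sum_{j=1}^n \langle y_i, K(u_i,u_j)y_j\rangle_{\mathcal{Y}} \geq 0$ for all $n\in\mathbb{N}$, $u_1,\dots,u_n\in\mathcal{U}$ and $y_1,\dots,y_n\in\mathcal{Y}$. $K$ is a reproducing kernel for a real Hilbert space $\mathcal{H}$ of operators from $\mathcal{U}$ to $\mathcal{Y}$ if (i) $K(\cdot,u)y \in \mathcal{H}$ for all $u\in\mathcal{U}$, $y\in\mathcal{Y}$, and (ii) $\langle y, H(u)\rangle_{\mathcal{Y}} = \langle H, K(\cdot,u)y\rangle_{\mathcal{H}}$ for all $u\in\mathcal{U}$, $y\in\mathcal{Y}$, $H\in\mathcal{H}$. Every symmetric positive semidefinite $K$ is the reproducing kernel of a unique such Hilbert space $\mathcal{H}$ (Moore–Aronszajn), called its associated reproducing kernel Hilbert space. The regularized least squares problem in the claim has a unique solution in $\mathcal{H}$ for every $\gamma>0$; it is $\hat{H}(\cdot)=\sum_{j=1}^n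 K(\cdot,u_j)c_j$, where $(c_1,\dots,c_n)\in\mathcal{Y}^n$ is the unique solution of $(G+\gamma I)(c_1,\dots,c_n)=(y_1,\dots,y_n)$ (the known representer theorem). $K$ is nonexpansive if for all $u,v\in\mathcal{U}$ $$\|K(u,u)-K(u,v)-K(v,u)+K(v,v)\|_{\mathcal{B}(\mathcal{Y})}^{\frac12} \leq \|u-v\|_{\mathcal{U}}.$$ $\mathcal{Y}^n$ is the Hilbert space of $n$-tuples with inner product $\langle (y_1,\dots,y_n),(z_1,\dots,z_n)\rangle_{\mathcal{Y}^n} = \sum_{i=1}^n \langle y_i,z_i\rangle_{\mathcal{Y}}$. The Gram operator associated with $K$ and $u_1,\dots,u_n$ is $$G(y_1,\dots,y_n) = \left(\sum_{j=1}^n K(u_1,u_j)y_j,\dots,\sum_{j=1}^n K(u_n,u_j)y_j\right).$$ For symmetric positive semidefinite $K$, $G$ is a bounded self-adjoint positive operator, and $G^{\frac12}$ denotes its unique self-adjoint positive square root. A map $R:\mathcal{U}\to\mathcal{Y}$ is Lipschitz continuous with constant $\ell\ge 0$ if $\|R(u)-R(v)\|_{\mathcal{Y}}\le \ell\|u-v\|_{\mathcal{U}}$ for all $u,v\in\mathcal{U}$ ($\ell$ need not be the smallest such constant). *)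

theory Defs
  imports "HOL-Analysis.Analysis"
begin

text \<open>The library constant \<^const>\<open>adjoint\<close> is given by a choice operator; on a Hilbert
  space the adjoint of a bounded operator exists and is unique, so the choice is determined.\<close>

definition symmetric_kernel :: "('u \<Rightarrow> 'u \<Rightarrow> ('y::real_inner \<Rightarrow>\<^sub>L 'y)) \<Rightarrow> bool"
  where "symmetric_kernel K \<longleftrightarrow>
    (\<forall>u v. adjoint (blinfun_apply (K u v)) = blinfun_apply (K v u))"

definition psd_kernel :: "('u \<Rightarrow> 'u \<Rightarrow> ('y::real_inner \<Rightarrow>\<^sub>L 'y)) \<Rightarrow> bool"
  where "psd_kernel K \<longleftrightarrow>
    (\<forall>(n::nat) (u :: nat \<Rightarrow> 'u) (y :: nat \<Rightarrow> 'y).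
      0 \<le> (\<Sum>i<n. \<Sum>j<n. y i \<bullet> blinfun_apply (K (u i) (u j)) (y j)))"

definition nonexpansive_kernel ::
    "('u::real_normed_vector \<Rightarrow> 'u \<Rightarrow> ('y::real_normed_vector \<Rightarrow>\<^sub>L 'y)) \<Rightarrow> bool"
  where "nonexpansive_kernel K \<longleftrightarrow>
    (\<forall>u v. sqrt (norm (K u u - K u v - K v u + K v v)) \<le> norm (u - v))"

definition ip_norm :: "('h \<Rightarrow> 'h \<Rightarrow> real) \<Rightarrow> 'h \<Rightarrow> real"
  where "ip_norm ip f = sqrt (ip f f)"

text \<open>A Hilbert space whose elements are (arbitrary) maps, with pointwise vector space
  operations. The inner product \<open>ip\<close> is only constrained on the carrier \<open>H\<close>.\<close>

locale operator_hilbert_space =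
  fixes H :: "('u \<Rightarrow> 'y::real_vector) set"
    and ip :: "('u \<Rightarrow> 'y) \<Rightarrow> ('u \<Rightarrow> 'y) \<Rightarrow> real"
  assumes zero_mem: "(\<lambda>u. 0) \<in> H"
    and add_mem: "\<lbrakk>f \<in> H; g \<in> H\<rbrakk> \<Longrightarrow> (\<lambda>u. f u + g u) \<in> H"
    and scaleR_mem: "f \<in> H \<Longrightarrow> (\<lambda>u. c *\<^sub>R f u) \<in> H"
    and ip_commute: "\<lbrakk>f \<in> H; g \<in> H\<rbrakk> \<Longrightarrow> ip f g = ip g f"
    and ip_add_left: "\<lbrakk>f \<in> H; g \<in> H; h \<in> H\<rbrakk> \<Longrightarrow> ip (\<lambda>u. f u + g u) h = ip f h + ip g h"
    and ip_scaleR_left: "\<lbrakk>f \<in> H; g \<in> H\<rbrakk> \<Longrightarrow> ip (\<lambda>u. c *\<^sub>R f u) g = c * ip f g"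
    and ip_nonneg: "f \<in> H \<Longrightarrow> 0 \<le> ip f f"
    and ip_eq_zero: "\<lbrakk>f \<in> H; ip f f = 0\<rbrakk> \<Longrightarrow> f = (\<lambda>u. 0)"
    and complete: "Metric_space.mcomplete H (\<lambda>f g. ip_norm ip (\<lambda>u. f u - g u))"

definition reproducing_kernel ::
    "('u \<Rightarrow> 'y::real_inner) set \<Rightarrow> (('u \<Rightarrow> 'y) \<Rightarrow> ('u \<Rightarrow> 'y) \<Rightarrow> real) \<Rightarrow>
     ('u \<Rightarrow> 'u \<Rightarrow> ('y \<Rightarrow>\<^sub>L 'y)) \<Rightarrow> bool"
  where "reproducing_kernel H ip K \<longleftrightarrow>
    (\<forall>u y. (\<lambda>v. blinfun_apply (K v u) y) \<in> H) \<and>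
    (\<forall>u y. \<forall>h\<in>H. y \<bullet> h u = ip h (\<lambda>v. blinfun_apply (K v u) y))"

definition is_rkhs ::
    "('u \<Rightarrow> 'u \<Rightarrow> ('y::real_inner \<Rightarrow>\<^sub>L 'y)) \<Rightarrow>
     ('u \<Rightarrow> 'y) set \<Rightarrow> (('u \<Rightarrow> 'y) \<Rightarrow> ('u \<Rightarrow> 'y) \<Rightarrow> real) \<Rightarrow> bool"
  where "is_rkhs K H ip \<longleftrightarrow> operator_hilbert_space H ip \<and> reproducing_kernel H ip K"

definition rls_objective ::
    "(('u \<Rightarrow> 'y) \<Rightarrow> ('u \<Rightarrow> 'y) \<Rightarrow> real) \<Rightarrow> 'u ^ 'n \<Rightarrow> ('y::real_normed_vector) ^ 'n \<Rightarrow> real \<Rightarrow>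
     ('u \<Rightarrow> 'y) \<Rightarrow> real"
  where "rls_objective ip us ys \<gamma> h =
    (\<Sum>i\<in>UNIV. (norm (ys $ i - h (us $ i)))\<^sup>2) + \<gamma> * (ip_norm ip h)\<^sup>2"

text \<open>The minimizer is unique for \<open>\<gamma> > 0\<close> when \<open>H\<close> is a reproducing kernel Hilbert space.\<close>

definition rls_solution ::
    "('u \<Rightarrow> 'y) set \<Rightarrow> (('u \<Rightarrow> 'y) \<Rightarrow> ('u \<Rightarrow> 'y) \<Rightarrow> real) \<Rightarrow>
     'u ^ 'n \<Rightarrow> ('y::real_normed_vector) ^ 'n \<Rightarrow> real \<Rightarrow> ('u \<Rightarrow> 'y)"
  where "rls_solution H ip us ys \<gamma> =
    (THE h. is_arg_min (rls_objective ip us ys \<gamma>) (\<lambda>f. f \<in> H) h)"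

definition gram :: "('u \<Rightarrow> 'u \<Rightarrow> ('y::real_normed_vector \<Rightarrow>\<^sub>L 'y)) \<Rightarrow> 'u ^ 'n \<Rightarrow> 'y ^ 'n \<Rightarrow> 'y ^ 'n"
  where "gram K us ys = (\<chi> i. \<Sum>j\<in>UNIV. blinfun_apply (K (us $ i) (us $ j)) (ys $ j))"

definition self_adjoint_positive :: "('a::real_inner \<Rightarrow> 'a) \<Rightarrow> bool"
  where "self_adjoint_positive A \<longleftrightarrow>
    bounded_linear A \<and> (\<forall>x y. A x \<bullet> y = x \<bullet> A y) \<and> (\<forall>x. 0 \<le> x \<bullet> A x)"

text \<open>Meaningful for self-adjoint positive \<open>A\<close> on a Hilbert space, where \<open>S\<close> exists and is unique.\<close>

definition operator_sqrt :: "('a::real_inner \<Rightarrow> 'a) \<Rightarrow> ('a \<Rightarrow> 'a)"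
  where "operator_sqrt A = (THE S. self_adjoint_positive S \<and> S \<circ> S = A)"

end

theory Submission
  imports Defs
begin

text \<open>
  For \<open>y = h u - h v\<close> the reproducing property writes \<open>\<parallel>y\<parallel>\<^sup>2\<close> as the inner product of \<open>h\<close> with
  \<open>d = K(\<cdot>, u) y - K(\<cdot>, v) y\<close>, and \<open>\<parallel>d\<parallel>\<^sup>2 = \<langle>y, (K(u,u) - K(u,v) - K(v,u) + K(v,v)) y\<rangle>\<close> is at
  most \<open>\<parallel>y\<parallel>\<^sup>2 \<parallel>u - v\<parallel>\<^sup>2\<close> for a nonexpansive kernel. The Cauchy-Schwarz inequality in the function
  space gives the Lipschitz bound (\<open>rkhs_lipschitz\<close>).

  For the norm of the regularized least squares solution, let \<open>c\<close> solve \<open>G c + \<gamma> c = y\<close> and put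
  \<open>f = \<Sum>\<^sub>j K(\<cdot>, u\<^sub>j) c\<^sub>j\<close>. The residual of \<open>f\<close> at \<open>u\<^sub>i\<close> is \<open>\<gamma> c\<^sub>i\<close>, and the inner product of \<open>f\<close>
  with any \<open>e\<close> is \<open>\<Sum>\<^sub>j \<langle>c\<^sub>j, e(u\<^sub>j)\<rangle>\<close>, so the cross terms cancel and the objective at \<open>f + e\<close>
  exceeds the one at \<open>f\<close> by \<open>\<Sum>\<^sub>i \<parallel>e(u\<^sub>i)\<parallel>\<^sup>2 + \<gamma> \<parallel>e\<parallel>\<^sup>2\<close> (\<open>rls_objective_eq\<close>). Hence \<open>f\<close> is the unique
  minimizer, and \<open>\<parallel>f\<parallel>\<^sup>2 = \<langle>c, G c\<rangle>\<close>, which is the squared norm of the square root of \<open>G\<close> at \<open>c\<close>.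

  Two facts about a self-adjoint positive operator \<open>A\<close> on a Hilbert space are needed: \<open>A + \<gamma> I\<close> is
  bijective (\<open>bij_positive_shift\<close>, by the Banach fixed point theorem), and \<open>A\<close> has exactly one
  self-adjoint positive square root (\<open>operator_sqrt\<close>). After scaling \<open>A\<close> to norm at most 1, the
  root is \<open>I - Y\<close> where \<open>Y = (B + Y\<^sup>2)/2\<close> with \<open>B = I - A\<close>; \<open>Y\<close> is the limit of the iterates of this
  equation, whose increments are dominated by those of the scalar iteration for \<open>B = 1\<close>. This
  root commutes with every operator that commutes with \<open>A\<close>, in particular with any other root,
  and commuting positive roots coincide.
\<close>

section \<open>Positive quadratic forms\<close>

lemma square_le_mult_of_nonneg_quadratic:
  fixes a b c :: real
  assumes quad: "\<And>t. 0 \<le> a + 2 * t * b + t\<^sup>2 * c"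
  shows "b\<^sup>2 \<le> a * c"
proof (cases "c = 0")
  case False
  have "0 \<le> c"
  proof (rule ccontr)
    assume neg: "\<not> 0 \<le> c"
    \<comment> \<open>For \<open>c < 0\<close> the quadratic is negative at this large \<open>t\<close>.\<close>
    define t where "t = 1 + (\<bar>a\<bar> + 2 * \<bar>b\<bar>) / \<bar>c\<bar>"
    have t1: "1 \<le> t"
      by (simp add: t_def)
    have "t * \<bar>c\<bar> = \<bar>c\<bar> + \<bar>a\<bar> + 2 * \<bar>b\<bar>"
      using neg by (simp add: t_def field_simps)
    then have tc: "t * c = c - \<bar>a\<bar> - 2 * \<bar>b\<bar>"
      using neg by simp
    have "t\<^sup>2 * c = t * (c - \<bar>a\<bar> - 2 * \<bar>b\<bar>)"
      by (simp add: power2_eq_square tc mult.assoc)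
    then have "a + 2 * t * b + t\<^sup>2 * c = (a - t * \<bar>a\<bar>) + 2 * (t * (b - \<bar>b\<bar>)) + t * c"
      by (simp add: algebra_simps)
    moreover have "a \<le> t * \<bar>a\<bar>"
      using mult_right_mono[OF t1, of "\<bar>a\<bar>"] by simp
    moreover have "t * (b - \<bar>b\<bar>) \<le> 0"
      using t1 by (intro mult_nonneg_nonpos) auto
    moreover have "t * c < 0"
      using t1 neg by (intro mult_pos_neg) auto
    ultimately show False
      using quad[of t] by linarith
  qed
  then have "0 < c"
    using False by simp
  \<comment> \<open>The minimum of the quadratic, attained at \<open>t = - b / c\<close>.\<close>
  moreover have "0 \<le> a - b\<^sup>2 / c"
    using quad[of "- b / c"] False by (simp add: power2_eq_square field_simps)
  ultimately show ?thesis
    by (simp add: field_simps)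
next
  case True
  have "b = 0"
  proof (rule ccontr)
    assume "b \<noteq> 0"
    \<comment> \<open>At \<open>t = - (a + 1) / (2 b)\<close> the affine function \<open>a + 2 t b\<close> takes the value \<open>- 1\<close>.\<close>
    then show False
      using quad[of "- (a + 1) / (2 * b)"] True by (simp add: field_simps)
  qed
  then show ?thesis
    using True by simp
qed

lemma self_adjoint_positive_Cauchy_Schwarz:
  assumes A: "self_adjoint_positive A"
  shows "(x \<bullet> A y)\<^sup>2 \<le> (x \<bullet> A x) * (y \<bullet> A y)"
proof (rule square_le_mult_of_nonneg_quadratic)
  fix t :: real
  interpret A: bounded_linear A
    using A by (simp add: self_adjoint_positive_def)
  have "y \<bullet> A x = x \<bullet> A y"
    using A by (metis self_adjoint_positive_def inner_commute)
  then have "(x + t *\<^sub>R y) \<bullet> A (x + t *\<^sub>R y) = x \<bullet> A x + 2 * t * (x \<bullet> A y) + t\<^sup>2 * (y \<bullet> A y)"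
    by (simp add: A.add A.scaleR inner_add_left inner_add_right power2_eq_square algebra_simps)
  moreover have "0 \<le> (x + t *\<^sub>R y) \<bullet> A (x + t *\<^sub>R y)"
    using A by (simp add: self_adjoint_positive_def)
  ultimately show "0 \<le> x \<bullet> A x + 2 * t * (x \<bullet> A y) + t\<^sup>2 * (y \<bullet> A y)"
    by simp
qed

text \<open>Take \<open>y = A x\<close> in the Cauchy-Schwarz inequality for the form of \<open>A\<close>.\<close>

lemma self_adjoint_positive_norm_square_le:
  assumes A: "self_adjoint_positive A" and M: "\<And>x. norm (A x) \<le> M * norm x"
  shows "(norm (A x))\<^sup>2 \<le> M * (x \<bullet> A x)"
proof (cases "A x = 0")
  case False
  have pos: "0 \<le> x \<bullet> A x"
    using A by (simp add: self_adjoint_positive_def)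
  have "x \<bullet> A (A x) = (norm (A x))\<^sup>2"
    using A by (metis self_adjoint_positive_def power2_norm_eq_inner)
  then have "((norm (A x))\<^sup>2)\<^sup>2 \<le> (x \<bullet> A x) * (A x \<bullet> A (A x))"
    using self_adjoint_positive_Cauchy_Schwarz[OF A, of x "A x"] by simp
  also have "\<dots> \<le> (x \<bullet> A x) * (norm (A x) * (M * norm (A x)))"
  proof (intro mult_left_mono pos)
    have "A x \<bullet> A (A x) \<le> norm (A x) * norm (A (A x))"
      by (rule norm_cauchy_schwarz)
    also have "\<dots> \<le> norm (A x) * (M * norm (A x))"
      by (intro mult_left_mono M) simp
    finally show "A x \<bullet> A (A x) \<le> norm (A x) * (M * norm (A x))" .
  qed
  finally have "(norm (A x))\<^sup>2 * (norm (A x))\<^sup>2 \<le> (M * (x \<bullet> A x)) * (norm (A x))\<^sup>2"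
    by (simp add: power2_eq_square algebra_simps)
  then show ?thesis
    by (rule mult_right_le_imp_le) (use False in simp)
next
  case True
  then show ?thesis by simp
qed

lemma self_adjoint_positive_kernel:
  assumes A: "self_adjoint_positive A" and "x \<bullet> A x = 0"
  shows "A x = 0"
proof -
  obtain M where "\<And>x. norm (A x) \<le> norm x * M"
    using A bounded_linear.bounded unfolding self_adjoint_positive_def by blast
  then have "(norm (A x))\<^sup>2 \<le> M * (x \<bullet> A x)"
    by (intro self_adjoint_positive_norm_square_le[OF A]) (simp add: mult.commute)
  then show ?thesis
    using assms(2) by simp
qed

section \<open>The positive square root\<close>

text \<open>The iterates of \<open>X \<mapsto> (B + X\<^sup>2)/2\<close> from \<open>X = 0\<close>, as maps on vectors, so that \<open>X\<^sup>2\<close> is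
  \<open>X\<close> composed with itself. A fixed point \<open>X\<close> satisfies \<open>(I - X)\<^sup>2 = I - B\<close>.\<close>

primrec sqrt_iter :: "('a::real_vector \<Rightarrow> 'a) \<Rightarrow> nat \<Rightarrow> 'a \<Rightarrow> 'a" where
  "sqrt_iter B 0 = (\<lambda>x. 0)"
| "sqrt_iter B (Suc n) = (\<lambda>x. (1/2) *\<^sub>R (B x + sqrt_iter B n (sqrt_iter B n x)))"

text \<open>The same iteration for the scalar \<open>B = 1\<close>; it increases and stays in the unit interval.\<close>

primrec sqrt_weight :: "nat \<Rightarrow> real" where
  "sqrt_weight 0 = 0"
| "sqrt_weight (Suc n) = (1 + (sqrt_weight n)\<^sup>2) / 2"

lemma sqrt_weight_bounds: "0 \<le> sqrt_weight n \<and> sqrt_weight n \<le> 1"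
proof (induction n)
  case (Suc n)
  then have "(sqrt_weight n)\<^sup>2 \<le> 1"
    by (simp add: power_le_one)
  then show ?case by simp
qed simp

lemma sqrt_weight_convergent: "convergent sqrt_weight"
proof -
  have "sqrt_weight n \<le> sqrt_weight (Suc n)" for n
    using zero_le_power2[of "1 - sqrt_weight n"] by (simp add: power2_diff)
  then have "incseq sqrt_weight"
    by (rule incseq_SucI)
  moreover have "\<forall>n. sqrt_weight n \<le> 1"
    using sqrt_weight_bounds by simp
  ultimately show ?thesis
    by (rule incseq_convergent) (rule convergentI)
qed

lemma linear_sqrt_iter:
  assumes "linear B"
  shows "linear (sqrt_iter B n)"
proof (induction n)
  case (Suc n)
  have "linear (\<lambda>x. sqrt_iter B n (sqrt_iter B n x))"
    using linear_compose[OF Suc Suc] by (simp add: o_def)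
  then have "linear (\<lambda>x. (1/2) *\<^sub>R (B x + sqrt_iter B n (sqrt_iter B n x)))"
    using assms by (intro linear_compose_scale_right linear_compose_add)
  then show ?case by simp
qed (simp add: linear_zero)

lemma sqrt_iter_commute:
  assumes T: "linear T" and TB: "\<And>x. T (B x) = B (T x)"
  shows "T (sqrt_iter B n x) = sqrt_iter B n (T x)"
proof (induction n arbitrary: x)
  case (Suc n)
  then show ?case
    by (simp add: linear_scale[OF T] linear_add[OF T] TB)
qed (simp add: linear_0[OF T])

lemma sqrt_iter_commute_self:
  assumes B: "linear B"
  shows "sqrt_iter B m (sqrt_iter B n x) = sqrt_iter B n (sqrt_iter B m x)"
proof (rule sqrt_iter_commute[OF linear_sqrt_iter[OF B]])
  show "sqrt_iter B m (B z) = B (sqrt_iter B m z)" for z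
    using sqrt_iter_commute[where T = B and B = B, OF B refl] by simp
qed

lemma norm_sqrt_iter_le:
  assumes B: "\<And>x. norm (B x) \<le> norm x"
  shows "norm (sqrt_iter B n x) \<le> sqrt_weight n * norm x"
proof (induction n arbitrary: x)
  case (Suc n)
  have "norm (sqrt_iter B n (sqrt_iter B n x)) \<le> sqrt_weight n * (sqrt_weight n * norm x)"
    using Suc[of "sqrt_iter B n x"] mult_left_mono[OF Suc[of x], of "sqrt_weight n"]
      sqrt_weight_bounds[of n] by linarith
  then have "norm (B x + sqrt_iter B n (sqrt_iter B n x)) \<le> norm x + (sqrt_weight n)\<^sup>2 * norm x"
    using norm_triangle_ineq[of "B x" "sqrt_iter B n (sqrt_iter B n x)"] B[of x]
    by (simp add: power2_eq_square mult.assoc)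
  then have "norm ((1/2) *\<^sub>R (B x + sqrt_iter B n (sqrt_iter B n x)))
      \<le> (norm x + (sqrt_weight n)\<^sup>2 * norm x) / 2"
    by (simp only: norm_scaleR) simp
  then show ?case by (simp add: distrib_right)
qed simp

text \<open>The factorisation \<open>X'\<^sup>2 - X\<^sup>2 = (X' + X) (X' - X)\<close> for commuting operators lets the
  scalar iteration dominate the increments of the operator iteration.\<close>

lemma norm_sqrt_iter_step_le:
  assumes lin: "linear B" and B: "\<And>x. norm (B x) \<le> norm x"
  shows "norm (sqrt_iter B (Suc n) x - sqrt_iter B n x)
           \<le> (sqrt_weight (Suc n) - sqrt_weight n) * norm x"
proof (induction n)
  case 0
  then show ?case using B[of x] by simp
next
  case (Suc n)
  define X where "X = sqrt_iter B n"
  define X' where "X' = sqrt_iter B (Suc n)"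
  define d where "d = X' x - X x"
  define v where "v = sqrt_weight n"
  define w where "w = sqrt_weight (Suc n)"
  have IH: "norm d \<le> (w - v) * norm x"
    using Suc by (simp only: d_def X_def X'_def v_def w_def)
  have linX: "linear X" "linear X'"
    unfolding X_def X'_def by (intro linear_sqrt_iter lin)+
  have nonneg: "0 \<le> v" "0 \<le> w"
    using sqrt_weight_bounds[of n] sqrt_weight_bounds[of "Suc n"] unfolding v_def w_def by blast+
  have comm: "X' (X x) = X (X' x)"
    unfolding X_def X'_def by (rule sqrt_iter_commute_self[OF lin])
  have fact: "X' (X' x) - X (X x) = X' d + X d"
    by (simp add: d_def linear_diff[OF linX(1)] linear_diff[OF linX(2)] comm)
  have "norm (X' d + X d) \<le> (w + v) * norm d"
    using norm_triangle_ineq[of "X' d" "X d"] norm_sqrt_iter_le[OF B, of "Suc n" d]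
      norm_sqrt_iter_le[OF B, of n d]
    unfolding X_def[symmetric] X'_def[symmetric] v_def[symmetric] w_def[symmetric]
    by (simp only: distrib_right)
  also have "\<dots> \<le> (w + v) * ((w - v) * norm x)"
    using IH nonneg by (intro mult_left_mono) auto
  also have "\<dots> = (w\<^sup>2 - v\<^sup>2) * norm x"
    by (simp add: power2_eq_square algebra_simps)
  finally have "norm (X' (X' x) - X (X x)) \<le> (w\<^sup>2 - v\<^sup>2) * norm x"
    by (simp add: fact)
  moreover have "sqrt_iter B (Suc (Suc n)) x - sqrt_iter B (Suc n) x
      = (1/2) *\<^sub>R (X' (X' x) - X (X x))"
    unfolding sqrt_iter.simps(2)[of B "Suc n"] X'_def[symmetric]
    by (simp add: X'_def X_def scaleR_diff_right[symmetric])
  moreover have "sqrt_weight (Suc (Suc n)) - sqrt_weight (Suc n) = (w\<^sup>2 - v\<^sup>2) / 2"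
    unfolding sqrt_weight.simps(2)[of "Suc n"] w_def[symmetric]
    by (simp add: w_def v_def field_simps)
  ultimately show ?case
    by (simp only: norm_scaleR)
qed

lemma norm_sqrt_iter_diff_le:
  assumes "linear B" and "\<And>x. norm (B x) \<le> norm x" and "n \<le> m"
  shows "norm (sqrt_iter B m x - sqrt_iter B n x)
           \<le> (sqrt_weight m - sqrt_weight n) * norm x"
  using \<open>n \<le> m\<close>
proof (induction m rule: dec_induct)
  case (step m)
  have "norm (sqrt_iter B (Suc m) x - sqrt_iter B n x)
      \<le> norm (sqrt_iter B (Suc m) x - sqrt_iter B m x) + norm (sqrt_iter B m x - sqrt_iter B n x)"
    by (rule norm_diff_triangle_ineq[of "sqrt_iter B (Suc m) x" "sqrt_iter B m x"
        "sqrt_iter B m x" "sqrt_iter B n x", THEN order_trans[rotated]]) simp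
  also have "\<dots> \<le> (sqrt_weight (Suc m) - sqrt_weight m) * norm x
      + (sqrt_weight m - sqrt_weight n) * norm x"
    by (intro add_mono norm_sqrt_iter_step_le assms(1,2) step.IH)
  finally show ?case by (simp only: left_diff_distrib)
qed simp

lemma sqrt_iter_inner:
  assumes "\<And>x y. B x \<bullet> y = x \<bullet> B y"
  shows "sqrt_iter B n x \<bullet> y = x \<bullet> sqrt_iter B n y"
proof (induction n arbitrary: x y)
  case (Suc n)
  then show ?case
    by (simp add: inner_add_left inner_add_right assms)
qed simp

lemma sqrt_iter_convergent:
  fixes B :: "'a::{real_normed_vector, complete_space} \<Rightarrow> 'a"
  assumes lin: "linear B" and B: "\<And>x. norm (B x) \<le> norm x"
  shows "convergent (\<lambda>n. sqrt_iter B n x)"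
proof -
  have "Cauchy (\<lambda>n. sqrt_iter B n x)"
  proof (rule CauchyI)
    fix e :: real
    assume e: "0 < e"
    obtain N where N: "\<And>m n. N \<le> m \<Longrightarrow> N \<le> n \<Longrightarrow>
        norm (sqrt_weight m - sqrt_weight n) < e / (norm x + 1)"
      using CauchyD[OF convergent_Cauchy[OF sqrt_weight_convergent], of "e / (norm x + 1)"] e
      by (auto simp: add_nonneg_pos)
    have le: "norm (sqrt_iter B m x - sqrt_iter B n x) < e" if "N \<le> n" "n \<le> m" for m n
    proof -
      have "norm (sqrt_iter B m x - sqrt_iter B n x) \<le> (sqrt_weight m - sqrt_weight n) * norm x"
        by (rule norm_sqrt_iter_diff_le[OF lin B that(2)])
      also have "\<dots> \<le> e / (norm x + 1) * norm x"
        using N[of m n] that by (intro mult_right_mono) auto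
      also have "\<dots> < e"
        using e by (simp add: pos_divide_less_eq add_nonneg_pos)
      finally show ?thesis .
    qed
    show "\<exists>M. \<forall>m\<ge>M. \<forall>n\<ge>M. norm (sqrt_iter B m x - sqrt_iter B n x) < e"
    proof (intro exI allI impI)
      fix m n assume "N \<le> m" "N \<le> n"
      then show "norm (sqrt_iter B m x - sqrt_iter B n x) < e"
        using le[of n m] le[of m n] by (cases "n \<le> m") (auto simp: norm_minus_commute)
    qed
  qed
  then show ?thesis
    by (rule Cauchy_convergent)
qed

text \<open>The square root found here commutes with everything that commutes with \<open>A\<close>. This is what
  makes it comparable with an arbitrary other root \<open>T\<close>, which commutes with \<open>A = T\<^sup>2\<close>.\<close>

lemma positive_sqrt_exists_contraction:
  fixes A :: "'a::{real_inner, complete_space} \<Rightarrow> 'a"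
  assumes A: "self_adjoint_positive A" and le1: "\<And>x. norm (A x) \<le> norm x"
  shows "\<exists>S. self_adjoint_positive S \<and> S \<circ> S = A
    \<and> (\<forall>T. bounded_linear T \<longrightarrow> T \<circ> A = A \<circ> T \<longrightarrow> T \<circ> S = S \<circ> T)"
proof -
  interpret A: bounded_linear A
    using A by (simp add: self_adjoint_positive_def)
  define B where "B = (\<lambda>x. x - A x)"
  have linB: "linear B"
    unfolding B_def by (intro linear_compose_sub linear_ident A.linear)
  have B_inner: "B x \<bullet> y = x \<bullet> B y" for x y
    using A by (simp add: B_def inner_diff_left inner_diff_right self_adjoint_positive_def)
  have B_norm: "norm (B x) \<le> norm x" for x
  proof -
    have "(norm (A x))\<^sup>2 \<le> 1 * (x \<bullet> A x)"
      using le1 by (intro self_adjoint_positive_norm_square_le[OF A]) simp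
    moreover have "0 \<le> x \<bullet> A x"
      using A by (simp add: self_adjoint_positive_def)
    moreover have "(norm (B x))\<^sup>2 = (norm x)\<^sup>2 - 2 * (x \<bullet> A x) + (norm (A x))\<^sup>2"
      by (simp add: B_def power2_norm_eq_inner inner_diff_left inner_diff_right inner_commute)
    ultimately have "(norm (B x))\<^sup>2 \<le> (norm x)\<^sup>2"
      by simp
    then show ?thesis
      by (rule power2_le_imp_le) simp
  qed
  define X where "X = sqrt_iter B"
  define Y where "Y = (\<lambda>x. lim (\<lambda>n. X n x))"
  have lim: "(\<lambda>n. X n x) \<longlonglongrightarrow> Y x" for x
    using sqrt_iter_convergent[OF linB B_norm] unfolding Y_def X_def
    by (simp add: convergent_LIMSEQ_iff)
  have linX: "linear (X n)" for n
    unfolding X_def by (rule linear_sqrt_iter[OF linB])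
  have X_norm: "norm (X n x) \<le> norm x" for n x
  proof -
    have "norm (X n x) \<le> sqrt_weight n * norm x"
      unfolding X_def by (rule norm_sqrt_iter_le[OF B_norm])
    also have "\<dots> \<le> 1 * norm x"
      using sqrt_weight_bounds by (intro mult_right_mono) auto
    finally show ?thesis by simp
  qed
  have Y_norm: "norm (Y x) \<le> norm x" for x
    by (rule LIMSEQ_le_const2[OF tendsto_norm[OF lim]]) (use X_norm in blast)
  have bl_Y: "bounded_linear Y"
  proof (rule bounded_linear_intro[where K = 1])
    fix x y and r :: real
    have "(\<lambda>n. X n (x + y)) \<longlonglongrightarrow> Y x + Y y"
      by (simp add: linear_add[OF linX] tendsto_add lim)
    then show "Y (x + y) = Y x + Y y"
      by (rule LIMSEQ_unique[OF lim])
    have "(\<lambda>n. X n (r *\<^sub>R x)) \<longlonglongrightarrow> r *\<^sub>R Y x"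
      by (simp add: linear_scale[OF linX] tendsto_scaleR lim)
    then show "Y (r *\<^sub>R x) = r *\<^sub>R Y x"
      by (rule LIMSEQ_unique[OF lim])
    show "norm (Y x) \<le> norm x * 1"
      using Y_norm by simp
  qed
  have Y_inner: "Y x \<bullet> y = x \<bullet> Y y" for x y
  proof (rule LIMSEQ_unique)
    show "(\<lambda>n. X n x \<bullet> y) \<longlonglongrightarrow> Y x \<bullet> y"
      by (intro tendsto_inner lim tendsto_const)
    have "X n x \<bullet> y = x \<bullet> X n y" for n
      unfolding X_def by (rule sqrt_iter_inner[OF B_inner])
    then show "(\<lambda>n. X n x \<bullet> y) \<longlonglongrightarrow> x \<bullet> Y y"
      by (simp add: tendsto_inner lim)
  qed
  have XX: "(\<lambda>n. X n (X n x)) \<longlonglongrightarrow> Y (Y x)" for x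
  proof -
    have "(\<lambda>n. X n (X n x - Y x)) \<longlonglongrightarrow> 0"
    proof (rule Lim_null_comparison)
      show "\<forall>\<^sub>F n in sequentially. norm (X n (X n x - Y x)) \<le> norm (X n x - Y x)"
        by (intro always_eventually allI X_norm)
      show "(\<lambda>n. norm (X n x - Y x)) \<longlonglongrightarrow> 0"
        using lim[of x] by (simp add: LIM_zero tendsto_norm_zero)
    qed
    then have "(\<lambda>n. X n (X n x - Y x) + X n (Y x)) \<longlonglongrightarrow> 0 + Y (Y x)"
      by (intro tendsto_add lim)
    then show ?thesis
      by (simp add: linear_diff[OF linX])
  qed
  have fix_eq: "Y x = (1/2) *\<^sub>R (B x + Y (Y x))" for x
  proof (rule LIMSEQ_unique)
    show "(\<lambda>n. X (Suc n) x) \<longlonglongrightarrow> Y x"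
      by (rule LIMSEQ_Suc[OF lim])
    have "(\<lambda>n. (1/2) *\<^sub>R (B x + X n (X n x))) \<longlonglongrightarrow> (1/2) *\<^sub>R (B x + Y (Y x))"
      by (intro tendsto_intros XX)
    then show "(\<lambda>n. X (Suc n) x) \<longlonglongrightarrow> (1/2) *\<^sub>R (B x + Y (Y x))"
      by (simp add: X_def)
  qed
  define S where "S = (\<lambda>x. x - Y x)"
  have bl_S: "bounded_linear S"
    unfolding S_def by (intro bounded_linear_sub bounded_linear_ident bl_Y)
  have "S (S x) = A x" for x
  proof -
    have "Y x + Y x = B x + Y (Y x)"
      using arg_cong[OF fix_eq[of x], of "\<lambda>z. 2 *\<^sub>R z"] by (simp add: scaleR_2)
    then show ?thesis
      by (simp add: S_def B_def linear_diff[OF bounded_linear.linear[OF bl_Y]] algebra_simps)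
  qed
  then have "S \<circ> S = A"
    by (simp add: fun_eq_iff)
  moreover have "self_adjoint_positive S"
    unfolding self_adjoint_positive_def
  proof (intro conjI allI bl_S)
    fix x y
    show "S x \<bullet> y = x \<bullet> S y"
      by (simp add: S_def inner_diff_left inner_diff_right Y_inner)
    have "x \<bullet> Y x \<le> norm x * norm x"
      using norm_cauchy_schwarz[of x "Y x"] mult_left_mono[OF Y_norm[of x], of "norm x"] by simp
    then show "0 \<le> x \<bullet> S x"
      by (simp add: S_def inner_diff_right power2_norm_eq_inner[symmetric] power2_eq_square)
  qed
  moreover have "T \<circ> S = S \<circ> T" if T: "bounded_linear T" and TA: "T \<circ> A = A \<circ> T" for T
  proof -
    interpret T: bounded_linear T by (rule T)
    have TB: "T (B x) = B (T x)" for x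
      using fun_cong[OF TA, of x] by (simp add: B_def T.diff)
    have "T (Y x) = Y (T x)" for x
    proof (rule LIMSEQ_unique)
      show "(\<lambda>n. T (X n x)) \<longlonglongrightarrow> T (Y x)"
        by (rule T.tendsto[OF lim])
      have "T (X n x) = X n (T x)" for n
        unfolding X_def by (rule sqrt_iter_commute[where T = T and B = B, OF T.linear TB])
      then show "(\<lambda>n. T (X n x)) \<longlonglongrightarrow> Y (T x)"
        by (simp add: lim)
    qed
    then show ?thesis
      by (simp add: fun_eq_iff S_def T.diff)
  qed
  ultimately show ?thesis by blast
qed

lemma self_adjoint_positive_scaleR:
  assumes "self_adjoint_positive A" and "0 \<le> c"
  shows "self_adjoint_positive (\<lambda>x. c *\<^sub>R A x)"
  using assms bounded_linear_const_scaleR[of A c] by (simp add: self_adjoint_positive_def)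

lemma positive_sqrt_exists:
  fixes A :: "'a::{real_inner, complete_space} \<Rightarrow> 'a"
  assumes A: "self_adjoint_positive A"
  shows "\<exists>S. self_adjoint_positive S \<and> S \<circ> S = A
    \<and> (\<forall>T. bounded_linear T \<longrightarrow> T \<circ> A = A \<circ> T \<longrightarrow> T \<circ> S = S \<circ> T)"
proof -
  have bl: "bounded_linear A"
    using A by (simp add: self_adjoint_positive_def)
  then obtain M where M: "0 < M" "\<And>x. norm (A x) \<le> norm x * M"
    using bounded_linear.pos_bounded by blast
  define A' where "A' = (\<lambda>x. (1 / M) *\<^sub>R A x)"
  have "self_adjoint_positive A'"
    unfolding A'_def using A M(1) by (intro self_adjoint_positive_scaleR) auto
  moreover have "norm (A' x) \<le> norm x" for x
    using M by (simp add: A'_def field_simps)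
  ultimately obtain S' where S': "self_adjoint_positive S'" "S' \<circ> S' = A'"
    and comm: "\<And>T. bounded_linear T \<Longrightarrow> T \<circ> A' = A' \<circ> T \<Longrightarrow> T \<circ> S' = S' \<circ> T"
    using positive_sqrt_exists_contraction[of A'] by blast
  define S where "S = (\<lambda>x. sqrt M *\<^sub>R S' x)"
  have linS': "linear S'"
    using S'(1) by (simp add: self_adjoint_positive_def bounded_linear.linear)
  have "self_adjoint_positive S"
    unfolding S_def using M(1) by (intro self_adjoint_positive_scaleR S'(1)) auto
  moreover have "S (S x) = A x" for x
  proof -
    have "S (S x) = M *\<^sub>R S' (S' x)"
      using M(1) by (simp add: S_def linear_scale[OF linS'])
    also have "S' (S' x) = A' x"
      using fun_cong[OF S'(2), of x] by simp
    finally show ?thesis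
      using M(1) by (simp add: A'_def)
  qed
  then have "S \<circ> S = A"
    by (simp add: fun_eq_iff)
  moreover have "T \<circ> S = S \<circ> T" if T: "bounded_linear T" and TA: "T \<circ> A = A \<circ> T" for T
  proof -
    note T_scale = linear_scale[OF bounded_linear.linear[OF T]]
    have "T \<circ> A' = A' \<circ> T"
      using TA by (simp add: fun_eq_iff A'_def T_scale)
    then have "T \<circ> S' = S' \<circ> T"
      by (rule comm[OF T])
    then show ?thesis
      by (simp add: fun_eq_iff S_def T_scale)
  qed
  ultimately show ?thesis by blast
qed

text \<open>For \<open>y = (S - T) x\<close> commutation gives \<open>(S + T) y = (S\<^sup>2 - T\<^sup>2) x = 0\<close>, so both positive
  forms vanish at \<open>y\<close>.\<close>

lemma commuting_positive_sqrt_unique: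
  assumes S: "self_adjoint_positive S" and T: "self_adjoint_positive T"
    and eq: "S \<circ> S = T \<circ> T" and comm: "T \<circ> S = S \<circ> T"
  shows "S = T"
proof
  fix x
  have lin: "linear S" "linear T"
    using S T by (auto simp: self_adjoint_positive_def bounded_linear.linear)
  define y where "y = S x - T x"
  have sq: "S (S x) = T (T x)" and c: "T (S x) = S (T x)"
    using fun_cong[OF eq, of x] fun_cong[OF comm, of x] by auto
  have "S y + T y = 0"
    by (simp add: y_def linear_diff[OF lin(1)] linear_diff[OF lin(2)] sq c)
  then have "y \<bullet> S y + y \<bullet> T y = 0"
    by (simp add: inner_add_right[symmetric])
  moreover have "0 \<le> y \<bullet> S y" "0 \<le> y \<bullet> T y"
    using S T by (auto simp: self_adjoint_positive_def)
  ultimately have "y \<bullet> S y = 0" "y \<bullet> T y = 0"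
    by auto
  then have zero: "S y = 0" "T y = 0"
    by (simp_all add: self_adjoint_positive_kernel[OF S] self_adjoint_positive_kernel[OF T])
  have "y \<bullet> y = x \<bullet> S y - x \<bullet> T y"
    using S T by (simp add: y_def inner_diff_left self_adjoint_positive_def)
  then show "S x = T x"
    using zero by (simp add: y_def)
qed

lemma operator_sqrt:
  fixes A :: "'a::{real_inner, complete_space} \<Rightarrow> 'a"
  assumes A: "self_adjoint_positive A"
  shows "self_adjoint_positive (operator_sqrt A)" and "operator_sqrt A \<circ> operator_sqrt A = A"
proof -
  obtain S where S: "self_adjoint_positive S" "S \<circ> S = A"
    and comm: "\<And>T. bounded_linear T \<Longrightarrow> T \<circ> A = A \<circ> T \<Longrightarrow> T \<circ> S = S \<circ> T"
    using positive_sqrt_exists[OF A] by blast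
  have unique: "T = S" if T: "self_adjoint_positive T" "T \<circ> T = A" for T
  proof -
    have bl: "bounded_linear T"
      using T(1) by (simp add: self_adjoint_positive_def)
    have "T \<circ> A = A \<circ> T"
      unfolding T(2)[symmetric] by (rule o_assoc)
    then have "T \<circ> S = S \<circ> T"
      by (rule comm[OF bl])
    then show ?thesis
      using commuting_positive_sqrt_unique[OF S(1) T(1)] S(2) T(2) by metis
  qed
  have "operator_sqrt A = S"
    unfolding operator_sqrt_def by (intro the_equality conjI S unique) auto
  then show "self_adjoint_positive (operator_sqrt A)" "operator_sqrt A \<circ> operator_sqrt A = A"
    using S by simp_all
qed

lemma norm_operator_sqrt:
  fixes A :: "'a::{real_inner, complete_space} \<Rightarrow> 'a"
  assumes A: "self_adjoint_positive A"
  shows "norm (operator_sqrt A x) = sqrt (x \<bullet> A x)"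
proof -
  have "operator_sqrt A x \<bullet> operator_sqrt A x = x \<bullet> operator_sqrt A (operator_sqrt A x)"
    using operator_sqrt(1)[OF A] by (simp add: self_adjoint_positive_def)
  also have "\<dots> = x \<bullet> A x"
    using fun_cong[OF operator_sqrt(2)[OF A], of x] by simp
  finally show ?thesis
    by (simp add: norm_eq_sqrt_inner)
qed

section \<open>Positive shifts of positive operators\<close>

text \<open>A positive operator shifted by \<open>\<gamma> > 0\<close> is coercive, and for small \<open>t > 0\<close> the map
  \<open>z \<mapsto> z - t (A z + \<gamma> z - y)\<close> is a contraction; its fixed point is the unique solution of
  \<open>A z + \<gamma> z = y\<close>.\<close>

lemma bij_positive_shift:
  fixes A :: "'a::{real_inner, complete_space} \<Rightarrow> 'a"
  assumes A: "self_adjoint_positive A" and "0 < \<gamma>"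
  shows "bij (\<lambda>z. A z + \<gamma> *\<^sub>R z)"
proof -
  define C where "C = (\<lambda>z. A z + \<gamma> *\<^sub>R z)"
  have "bounded_linear C"
    unfolding C_def using A
    by (intro bounded_linear_add bounded_linear_const_scaleR bounded_linear_ident)
      (simp add: self_adjoint_positive_def)
  then interpret C: bounded_linear C .
  have coercive: "\<gamma> * (norm z)\<^sup>2 \<le> z \<bullet> C z" for z
    using A by (simp add: C_def inner_add_right self_adjoint_positive_def power2_norm_eq_inner)
  obtain M0 where M0: "\<And>z. norm (C z) \<le> norm z * M0"
    using C.bounded by blast
  define M where "M = max M0 \<gamma>"
  have M: "norm (C z) \<le> norm z * M" for z
    using M0[of z] mult_left_mono[of M0 M "norm z"] by (simp add: M_def)
  have "\<gamma> \<le> M" "0 < M"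
    using \<open>0 < \<gamma>\<close> by (auto simp: M_def)
  \<comment> \<open>The step \<open>t = \<gamma> / M\<^sup>2\<close> minimises the bound \<open>1 - 2 t \<gamma> + t\<^sup>2 M\<^sup>2\<close> on the squared
    contraction factor.\<close>
  define t where "t = \<gamma> / M\<^sup>2"
  define q where "q = 1 - \<gamma>\<^sup>2 / M\<^sup>2"
  have "\<gamma>\<^sup>2 \<le> M\<^sup>2"
    using \<open>\<gamma> \<le> M\<close> \<open>0 < \<gamma>\<close> by (intro power_mono) auto
  then have q: "0 \<le> q" "q < 1"
    using \<open>0 < M\<close> \<open>0 < \<gamma>\<close> by (auto simp: q_def)
  have contr: "norm (z - t *\<^sub>R C z) \<le> sqrt q * norm z" for z
  proof -
    have "(norm (z - t *\<^sub>R C z))\<^sup>2 = (norm z)\<^sup>2 - 2 * t * (z \<bullet> C z) + t\<^sup>2 * (norm (C z))\<^sup>2"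
      unfolding power2_norm_eq_inner
      by (simp add: inner_diff_left inner_diff_right inner_commute power2_eq_square)
    also have "\<dots> \<le> (norm z)\<^sup>2 - 2 * t * (\<gamma> * (norm z)\<^sup>2) + t\<^sup>2 * (norm z * M)\<^sup>2"
    proof -
      have "2 * t * (\<gamma> * (norm z)\<^sup>2) \<le> 2 * t * (z \<bullet> C z)"
        using \<open>0 < \<gamma>\<close> by (intro mult_left_mono coercive) (simp add: t_def)
      moreover have "t\<^sup>2 * (norm (C z))\<^sup>2 \<le> t\<^sup>2 * (norm z * M)\<^sup>2"
        by (intro mult_left_mono power_mono M) auto
      ultimately show ?thesis by linarith
    qed
    also have "\<dots> = q * (norm z)\<^sup>2"
      using \<open>0 < M\<close> by (simp add: t_def q_def power2_eq_square field_simps)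
    also have "\<dots> = (sqrt q * norm z)\<^sup>2"
      using q by (simp add: power_mult_distrib)
    finally show ?thesis
      by (rule power2_le_imp_le) (use q in simp)
  qed
  have "\<exists>!z. C z = y" for y
  proof -
    have "\<exists>!z. z - t *\<^sub>R (C z - y) = z"
    proof (rule banach_fix_type[of "sqrt q"])
      show "0 \<le> sqrt q" "sqrt q < 1"
        using q by (auto simp: real_less_lsqrt)
      show "\<forall>z w. dist (z - t *\<^sub>R (C z - y)) (w - t *\<^sub>R (C w - y)) \<le> sqrt q * dist z w"
      proof (intro allI)
        fix z w
        have "(z - t *\<^sub>R (C z - y)) - (w - t *\<^sub>R (C w - y)) = (z - w) - t *\<^sub>R C (z - w)"
          by (simp add: C.diff algebra_simps)
        then show "dist (z - t *\<^sub>R (C z - y)) (w - t *\<^sub>R (C w - y)) \<le> sqrt q * dist z w"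
          using contr[of "z - w"] by (simp only: dist_norm)
      qed
    qed
    moreover have "z - t *\<^sub>R (C z - y) = z \<longleftrightarrow> C z = y" for z
      using \<open>0 < \<gamma>\<close> \<open>0 < M\<close> by (simp add: t_def)
    ultimately show ?thesis by simp
  qed
  then show ?thesis
    by (simp add: bij_iff C_def)
qed

section \<open>Hilbert spaces of maps\<close>

context operator_hilbert_space
begin

lemma diff_mem: "\<lbrakk>f \<in> H; g \<in> H\<rbrakk> \<Longrightarrow> (\<lambda>u. f u - g u) \<in> H"
  using add_mem[of f "\<lambda>u. (- 1) *\<^sub>R g u"] scaleR_mem[of g "- 1"] by simp

lemma sum_mem: "(\<And>j. j \<in> J \<Longrightarrow> f j \<in> H) \<Longrightarrow> (\<lambda>u. \<Sum>j\<in>J. f j u) \<in> H"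
  by (induction J rule: infinite_finite_induct) (auto simp: zero_mem add_mem)

lemma ip_zero_left: "g \<in> H \<Longrightarrow> ip (\<lambda>u. 0) g = 0"
  using ip_scaleR_left[of g g 0] by simp

lemma ip_diff_left:
  "\<lbrakk>f \<in> H; g \<in> H; h \<in> H\<rbrakk> \<Longrightarrow> ip (\<lambda>u. f u - g u) h = ip f h - ip g h"
  using ip_add_left[of f "\<lambda>u. (- 1) *\<^sub>R g u" h] ip_scaleR_left[of g h "- 1"] scaleR_mem[of g "- 1"]
  by simp

lemma ip_diff_right:
  "\<lbrakk>f \<in> H; g \<in> H; h \<in> H\<rbrakk> \<Longrightarrow> ip f (\<lambda>u. g u - h u) = ip f g - ip f h"
  using ip_diff_left[of g h f] ip_commute[of f] diff_mem[of g h] by simp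

lemma ip_sum_left:
  "\<lbrakk>\<And>j. j \<in> J \<Longrightarrow> f j \<in> H; g \<in> H\<rbrakk> \<Longrightarrow> ip (\<lambda>u. \<Sum>j\<in>J. f j u) g = (\<Sum>j\<in>J. ip (f j) g)"
  by (induction J rule: infinite_finite_induct) (auto simp: ip_zero_left ip_add_left sum_mem)

lemma ip_add_scaleR_self:
  assumes f: "f \<in> H" and g: "g \<in> H"
  shows "ip (\<lambda>u. f u + t *\<^sub>R g u) (\<lambda>u. f u + t *\<^sub>R g u) = ip f f + 2 * t * ip f g + t\<^sup>2 * ip g g"
proof -
  have tg: "(\<lambda>u. t *\<^sub>R g u) \<in> H"
    by (rule scaleR_mem[OF g])
  have s: "(\<lambda>u. f u + t *\<^sub>R g u) \<in> H"
    by (rule add_mem[OF f tg])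
  have "ip h (\<lambda>u. f u + t *\<^sub>R g u) = ip h f + t * ip h g" if "h \<in> H" for h
    using that f g tg s by (simp add: ip_commute[of h] ip_add_left ip_scaleR_left)
  moreover have "ip (\<lambda>u. f u + t *\<^sub>R g u) (\<lambda>u. f u + t *\<^sub>R g u)
      = ip f (\<lambda>u. f u + t *\<^sub>R g u) + t * ip g (\<lambda>u. f u + t *\<^sub>R g u)"
    using f g tg s by (simp add: ip_add_left ip_scaleR_left)
  ultimately show ?thesis
    using f g by (simp add: ip_commute[of g f] power2_eq_square algebra_simps)
qed

lemma ip_norm_nonneg: "f \<in> H \<Longrightarrow> 0 \<le> ip_norm ip f"
  by (simp add: ip_norm_def ip_nonneg)

lemma ip_norm_square: "f \<in> H \<Longrightarrow> (ip_norm ip f)\<^sup>2 = ip f f"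
  by (simp add: ip_norm_def ip_nonneg)

lemma ip_Cauchy_Schwarz:
  assumes f: "f \<in> H" and g: "g \<in> H"
  shows "\<bar>ip f g\<bar> \<le> ip_norm ip f * ip_norm ip g"
proof -
  have "(ip f g)\<^sup>2 \<le> ip f f * ip g g"
  proof (rule square_le_mult_of_nonneg_quadratic)
    fix t
    have "0 \<le> ip (\<lambda>u. f u + t *\<^sub>R g u) (\<lambda>u. f u + t *\<^sub>R g u)"
      by (intro ip_nonneg add_mem scaleR_mem f g)
    then show "0 \<le> ip f f + 2 * t * ip f g + t\<^sup>2 * ip g g"
      by (simp add: ip_add_scaleR_self[OF f g])
  qed
  then have "\<bar>ip f g\<bar> \<le> sqrt (ip f f * ip g g)"
    by (rule real_le_rsqrt[of "\<bar>ip f g\<bar>", simplified])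
  then show ?thesis
    by (simp add: ip_norm_def real_sqrt_mult)
qed

end

section \<open>Reproducing kernels\<close>

lemma is_rkhs_section_mem:
  "is_rkhs K H ip \<Longrightarrow> (\<lambda>v. blinfun_apply (K v u) y) \<in> H"
  by (simp add: is_rkhs_def reproducing_kernel_def)

lemma is_rkhs_reproducing:
  "\<lbrakk>is_rkhs K H ip; h \<in> H\<rbrakk> \<Longrightarrow> ip h (\<lambda>v. blinfun_apply (K v u) y) = y \<bullet> h u"
  by (simp add: is_rkhs_def reproducing_kernel_def)

text \<open>Symmetry of the kernel follows from the symmetry of the inner product of the function space.\<close>

lemma is_rkhs_kernel_inner:
  assumes K: "is_rkhs K H ip"
  shows "blinfun_apply (K u v) x \<bullet> y = x \<bullet> blinfun_apply (K v u) y"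
proof -
  interpret operator_hilbert_space H ip
    using K by (simp add: is_rkhs_def)
  have "ip (\<lambda>w. blinfun_apply (K w v) x) (\<lambda>w. blinfun_apply (K w u) y)
      = ip (\<lambda>w. blinfun_apply (K w u) y) (\<lambda>w. blinfun_apply (K w v) x)"
    by (intro ip_commute is_rkhs_section_mem[OF K])
  then show ?thesis
    by (simp add: is_rkhs_reproducing[OF K is_rkhs_section_mem[OF K]] inner_commute)
qed

lemma rkhs_lipschitz:
  fixes K :: "'u::real_normed_vector \<Rightarrow> 'u \<Rightarrow> ('y::real_inner \<Rightarrow>\<^sub>L 'y)"
  assumes K: "is_rkhs K H ip" and ne: "nonexpansive_kernel K" and h: "h \<in> H"
  shows "(ip_norm ip h)-lipschitz_on UNIV h"
proof (rule lipschitz_onI)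
  interpret operator_hilbert_space H ip
    using K by (simp add: is_rkhs_def)
  show "0 \<le> ip_norm ip h"
    by (rule ip_norm_nonneg[OF h])
  fix u v
  define y where "y = h u - h v"
  define D where "D = K u u - K u v - K v u + K v v"
  define ku where "ku = (\<lambda>w. blinfun_apply (K w u) y)"
  define kv where "kv = (\<lambda>w. blinfun_apply (K w v) y)"
  define d where "d = (\<lambda>w. ku w - kv w)"
  have mem: "ku \<in> H" "kv \<in> H" "d \<in> H"
    unfolding ku_def kv_def d_def by (intro diff_mem is_rkhs_section_mem[OF K])+
  have pair: "ip f d = y \<bullet> (f u - f v)" if "f \<in> H" for f
  proof -
    have "ip f d = ip f ku - ip f kv"
      unfolding d_def using that mem by (intro ip_diff_right)
    then show ?thesis
      unfolding ku_def kv_def by (simp add: is_rkhs_reproducing[OF K that] inner_diff_right)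
  qed
  have "norm D \<le> (norm (u - v))\<^sup>2"
    using ne unfolding nonexpansive_kernel_def D_def by (blast dest: sqrt_le_D)
  have "ip d d = y \<bullet> blinfun_apply D y"
    unfolding pair[OF mem(3)]
    by (simp add: d_def ku_def kv_def D_def blinfun.diff_left blinfun.add_left algebra_simps)
  also have "\<dots> \<le> norm y * (norm D * norm y)"
    using norm_cauchy_schwarz[of y "blinfun_apply D y"]
      mult_left_mono[OF norm_blinfun[of D y], of "norm y"] by simp
  also have "\<dots> \<le> norm y * ((norm (u - v))\<^sup>2 * norm y)"
    using \<open>norm D \<le> _\<close> by (intro mult_left_mono mult_right_mono) auto
  also have "\<dots> = (norm y * norm (u - v))\<^sup>2"
    by (simp add: power2_eq_square)
  finally have "ip_norm ip d \<le> norm y * norm (u - v)"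
    unfolding ip_norm_def by (rule real_le_lsqrt[rotated]) simp
  have "norm y * norm y = ip h d"
    by (simp add: pair[OF h] y_def power2_norm_eq_inner[symmetric] power2_eq_square)
  also have "\<dots> \<le> ip_norm ip h * ip_norm ip d"
    using ip_Cauchy_Schwarz[OF h mem(3)] by simp
  also have "\<dots> \<le> ip_norm ip h * (norm y * norm (u - v))"
    by (intro mult_left_mono \<open>ip_norm ip d \<le> _\<close> ip_norm_nonneg h)
  finally have "norm y * norm y \<le> norm y * (ip_norm ip h * norm (u - v))"
    by (simp add: mult_ac)
  then have "norm y \<le> ip_norm ip h * norm (u - v)"
    using ip_norm_nonneg[OF h] by (cases "norm y = 0") (auto simp: mult_le_cancel_left)
  then show "dist (h u) (h v) \<le> ip_norm ip h * dist u v"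
    by (simp add: y_def dist_norm)
qed

section \<open>The Gram operator and regularized least squares\<close>

lemma rkhs_inner_expansion:
  fixes us :: "'u ^ 'n" and c :: "'y::real_inner ^ 'n"
  assumes K: "is_rkhs K H ip"
  defines "f \<equiv> \<lambda>v. \<Sum>j\<in>UNIV. blinfun_apply (K v (us $ j)) (c $ j)"
  shows "f \<in> H" and "h \<in> H \<Longrightarrow> ip f h = (\<Sum>j\<in>UNIV. c $ j \<bullet> h (us $ j))"
proof -
  interpret operator_hilbert_space H ip
    using K by (simp add: is_rkhs_def)
  note mem = is_rkhs_section_mem[OF K]
  show "f \<in> H"
    unfolding f_def by (intro sum_mem mem)
  show "ip f h = (\<Sum>j\<in>UNIV. c $ j \<bullet> h (us $ j))" if h: "h \<in> H"
    unfolding f_def using h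
    by (simp add: ip_sum_left mem ip_commute[OF mem h] is_rkhs_reproducing[OF K h])
qed

lemma bounded_linear_gram: "bounded_linear (gram K us)"
proof (rule bounded_linear_intro)
  fix x y r
  show "gram K us (x + y) = gram K us x + gram K us y"
    by (simp add: gram_def vec_eq_iff blinfun.add_right sum.distrib)
  show "gram K us (r *\<^sub>R x) = r *\<^sub>R gram K us x"
    by (simp add: gram_def vec_eq_iff blinfun.scaleR_right scaleR_sum_right)
  have "norm (gram K us x) \<le> (\<Sum>i\<in>UNIV. norm (gram K us x $ i))"
    unfolding norm_vec_def by (rule L2_set_le_sum) simp
  also have "\<dots> \<le> (\<Sum>i\<in>UNIV. \<Sum>j\<in>UNIV. norm x * norm (K (us $ i) (us $ j)))"
  proof (rule sum_mono)
    fix i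
    have "norm (gram K us x $ i) \<le> (\<Sum>j\<in>UNIV. norm (blinfun_apply (K (us $ i) (us $ j)) (x $ j)))"
      unfolding gram_def by (simp add: norm_sum)
    also have "\<dots> \<le> (\<Sum>j\<in>UNIV. norm x * norm (K (us $ i) (us $ j)))"
    proof (rule sum_mono)
      fix j
      have "norm (blinfun_apply (K (us $ i) (us $ j)) (x $ j))
          \<le> norm (K (us $ i) (us $ j)) * norm (x $ j)"
        by (rule norm_blinfun)
      also have "\<dots> \<le> norm (K (us $ i) (us $ j)) * norm x"
        by (intro mult_left_mono Finite_Cartesian_Product.norm_nth_le) simp
      finally show "norm (blinfun_apply (K (us $ i) (us $ j)) (x $ j))
          \<le> norm x * norm (K (us $ i) (us $ j))"
        by (simp add: mult.commute)
    qed
    finally show "norm (gram K us x $ i) \<le> (\<Sum>j\<in>UNIV. norm x * norm (K (us $ i) (us $ j)))" .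
  qed
  also have "\<dots> = norm x * (\<Sum>i\<in>UNIV. \<Sum>j\<in>UNIV. norm (K (us $ i) (us $ j)))"
    by (simp add: sum_distrib_left)
  finally show "norm (gram K us x) \<le> norm x * (\<Sum>i\<in>UNIV. \<Sum>j\<in>UNIV. norm (K (us $ i) (us $ j)))" .
qed

lemma ip_expansion_self:
  fixes us :: "'u ^ 'n" and c :: "'y::real_inner ^ 'n"
  assumes K: "is_rkhs K H ip"
  defines "f \<equiv> \<lambda>v. \<Sum>j\<in>UNIV. blinfun_apply (K v (us $ j)) (c $ j)"
  shows "ip f f = c \<bullet> gram K us c"
  using rkhs_inner_expansion[OF K, where us = us and c = c]
  by (simp add: f_def inner_vec_def gram_def)

lemma self_adjoint_positive_gram:
  fixes us :: "'u ^ 'n"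
  assumes K: "is_rkhs K H ip"
  shows "self_adjoint_positive (gram K us)"
  unfolding self_adjoint_positive_def
proof (intro conjI allI bounded_linear_gram)
  interpret operator_hilbert_space H ip
    using K by (simp add: is_rkhs_def)
  fix x y
  have "gram K us x \<bullet> y
      = (\<Sum>i\<in>UNIV. \<Sum>j\<in>UNIV. x $ j \<bullet> blinfun_apply (K (us $ j) (us $ i)) (y $ i))"
    by (simp add: inner_vec_def gram_def inner_sum_left is_rkhs_kernel_inner[OF K])
  also have "\<dots> = x \<bullet> gram K us y"
    by (subst sum.swap) (simp add: inner_vec_def gram_def inner_sum_right)
  finally show "gram K us x \<bullet> y = x \<bullet> gram K us y" .
  show "0 \<le> x \<bullet> gram K us x"
    unfolding ip_expansion_self[OF K, symmetric]
    by (intro ip_nonneg rkhs_inner_expansion(1)[OF K])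
qed

text \<open>Completing the square around the kernel expansion \<open>f\<close> whose coefficients solve
  \<open>G c + \<gamma> c = y\<close>: the objective splits with no cross term.\<close>

lemma rls_objective_eq:
  fixes us :: "'u ^ 'n" and c ys :: "'y::real_inner ^ 'n"
  assumes K: "is_rkhs K H ip" and c: "gram K us c + \<gamma> *\<^sub>R c = ys" and h: "h \<in> H"
  defines "f \<equiv> \<lambda>v. \<Sum>j\<in>UNIV. blinfun_apply (K v (us $ j)) (c $ j)"
  shows "rls_objective ip us ys \<gamma> h = rls_objective ip us ys \<gamma> f
    + (\<Sum>i\<in>UNIV. (norm (h (us $ i) - f (us $ i)))\<^sup>2) + \<gamma> * (ip_norm ip (\<lambda>u. h u - f u))\<^sup>2"
proof -
  interpret operator_hilbert_space H ip
    using K by (simp add: is_rkhs_def)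
  define e where "e = (\<lambda>u. h u - f u)"
  have f: "f \<in> H"
    unfolding f_def by (rule rkhs_inner_expansion(1)[OF K])
  have e: "e \<in> H"
    unfolding e_def by (intro diff_mem h f)
  have res: "ys $ i - f (us $ i) = \<gamma> *\<^sub>R c $ i" for i
    unfolding c[symmetric] by (simp add: gram_def f_def)
  have "(norm (ys $ i - h (us $ i)))\<^sup>2
      = (norm (ys $ i - f (us $ i)))\<^sup>2 - 2 * \<gamma> * (c $ i \<bullet> e (us $ i)) + (norm (e (us $ i)))\<^sup>2" for i
  proof -
    have "ys $ i - h (us $ i) = \<gamma> *\<^sub>R c $ i - e (us $ i)"
      unfolding e_def res[symmetric] by simp
    then show ?thesis
      unfolding res power2_norm_eq_inner
      by (simp add: inner_diff_left inner_diff_right inner_commute)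
  qed
  then have fit: "(\<Sum>i\<in>UNIV. (norm (ys $ i - h (us $ i)))\<^sup>2)
      = (\<Sum>i\<in>UNIV. (norm (ys $ i - f (us $ i)))\<^sup>2) - 2 * \<gamma> * (\<Sum>i\<in>UNIV. c $ i \<bullet> e (us $ i))
        + (\<Sum>i\<in>UNIV. (norm (e (us $ i)))\<^sup>2)"
    by (simp add: sum.distrib sum_subtractf sum_distrib_left)
  have "ip h h = ip f f + 2 * ip f e + ip e e"
    using ip_add_scaleR_self[OF f e, of 1] by (simp add: e_def)
  also have "ip f e = (\<Sum>i\<in>UNIV. c $ i \<bullet> e (us $ i))"
    unfolding f_def by (rule rkhs_inner_expansion(2)[OF K e])
  finally show ?thesis
    unfolding rls_objective_def fit
    by (simp add: ip_norm_square h f e e_def[symmetric] e_def[THEN fun_cong, symmetric] algebra_simps)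
qed

lemma rls_solution_eq:
  fixes us :: "'u ^ 'n" and c ys :: "'y::real_inner ^ 'n"
  assumes K: "is_rkhs K H ip" and "0 < \<gamma>" and c: "gram K us c + \<gamma> *\<^sub>R c = ys"
  shows "rls_solution H ip us ys \<gamma> = (\<lambda>v. \<Sum>j\<in>UNIV. blinfun_apply (K v (us $ j)) (c $ j))"
    (is "_ = ?f")
proof -
  interpret operator_hilbert_space H ip
    using K by (simp add: is_rkhs_def)
  note obj = rls_objective_eq[OF K c]
  have f: "?f \<in> H"
    by (rule rkhs_inner_expansion(1)[OF K])
  have le: "rls_objective ip us ys \<gamma> ?f + \<gamma> * (ip_norm ip (\<lambda>u. h u - ?f u))\<^sup>2
      \<le> rls_objective ip us ys \<gamma> h" if "h \<in> H" for h
    unfolding obj[OF that] by (simp add: sum_nonneg)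
  show ?thesis
    unfolding rls_solution_def
  proof (rule the_equality)
    have "rls_objective ip us ys \<gamma> ?f \<le> rls_objective ip us ys \<gamma> h" if "h \<in> H" for h
      using le[OF that] \<open>0 < \<gamma>\<close> by (smt (verit) mult_nonneg_nonneg zero_le_power2)
    then show "is_arg_min (rls_objective ip us ys \<gamma>) (\<lambda>f. f \<in> H) ?f"
      using f by (simp add: is_arg_min_linorder)
  next
    fix h
    assume "is_arg_min (rls_objective ip us ys \<gamma>) (\<lambda>f. f \<in> H) h"
    then have h: "h \<in> H" and "rls_objective ip us ys \<gamma> h \<le> rls_objective ip us ys \<gamma> ?f"
      using f by (auto simp: is_arg_min_linorder)
    then have "\<gamma> * (ip_norm ip (\<lambda>u. h u - ?f u))\<^sup>2 \<le> 0"
      using le[OF h] by linarith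
    then have "(ip_norm ip (\<lambda>u. h u - ?f u))\<^sup>2 = 0"
      using \<open>0 < \<gamma>\<close> by (simp add: mult_le_0_iff)
    then have "(\<lambda>u. h u - ?f u) = (\<lambda>u. 0)"
      using diff_mem[OF h f] by (intro ip_eq_zero) (simp_all add: ip_norm_square)
    then show "h = ?f"
      by (simp add: fun_eq_iff)
  qed
qed

theorem theorem8:
  fixes K :: "'u::{real_inner,complete_space} \<Rightarrow> 'u \<Rightarrow> ('y::{real_inner,complete_space} \<Rightarrow>\<^sub>L 'y)"
    and H :: "('u \<Rightarrow> 'y) set"
    and ip :: "('u \<Rightarrow> 'y) \<Rightarrow> ('u \<Rightarrow> 'y) \<Rightarrow> real"
    and us :: "'u ^ 'n"
    and ys :: "'y ^ 'n"
  assumes "symmetric_kernel K"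
    and "psd_kernel K"
    and "is_rkhs K H ip"
    and "nonexpansive_kernel K"
  shows "(\<forall>h\<in>H. (ip_norm ip h)-lipschitz_on UNIV h)
    \<and> (\<forall>\<gamma>>0. ip_norm ip (rls_solution H ip us ys \<gamma>)
          = norm (operator_sqrt (gram K us) (inv (\<lambda>z. gram K us z + \<gamma> *\<^sub>R z) ys)))
    \<and> (\<forall>\<gamma>>0. \<forall>l\<ge>0.
          norm (operator_sqrt (gram K us) (inv (\<lambda>z. gram K us z + \<gamma> *\<^sub>R z) ys)) \<le> l
          \<longrightarrow> l-lipschitz_on UNIV (rls_solution H ip us ys \<gamma>))"
proof -
  note K = assms(3)
  have lip: "(ip_norm ip h)-lipschitz_on UNIV h" if "h \<in> H" for h
    by (rule rkhs_lipschitz[OF K assms(4) that])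
  have sol: "rls_solution H ip us ys \<gamma> \<in> H"
    "ip_norm ip (rls_solution H ip us ys \<gamma>)
      = norm (operator_sqrt (gram K us) (inv (\<lambda>z. gram K us z + \<gamma> *\<^sub>R z) ys))"
    if "0 < \<gamma>" for \<gamma>
  proof -
    note G = self_adjoint_positive_gram[OF K, of us]
    define c where "c = inv (\<lambda>z. gram K us z + \<gamma> *\<^sub>R z) ys"
    have "gram K us c + \<gamma> *\<^sub>R c = ys"
      unfolding c_def
      by (rule surj_f_inv_f[OF bij_is_surj[OF bij_positive_shift[OF G that]]])
    note eq = rls_solution_eq[OF K that this]
    show "rls_solution H ip us ys \<gamma> \<in> H"
      unfolding eq by (rule rkhs_inner_expansion(1)[OF K])
    show "ip_norm ip (rls_solution H ip us ys \<gamma>)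
        = norm (operator_sqrt (gram K us) (inv (\<lambda>z. gram K us z + \<gamma> *\<^sub>R z) ys))"
      unfolding c_def[symmetric] norm_operator_sqrt[OF G] eq ip_norm_def ip_expansion_self[OF K] ..
  qed
  show ?thesis
  proof (intro conjI ballI allI impI lip sol(2))
    fix \<gamma> l :: real
    assume "0 < \<gamma>"
      and "norm (operator_sqrt (gram K us) (inv (\<lambda>z. gram K us z + \<gamma> *\<^sub>R z) ys)) \<le> l"
    then show "l-lipschitz_on UNIV (rls_solution H ip us ys \<gamma>)"
      using lipschitz_on_le[OF lip[OF sol(1)]] sol(2) by simp
  qed
qed

end
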